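(* For each $k\ge5$, there are infinitely many (pairwise non-isomorphic) connected non-regular unweighted graphs with maximum valency $k$ that admit pair state transfer, relative to each of $A$, $L$ and $Q$, between the same pair states at time $\frac{\pi}{2}$.
   Context: For an unweighted simple graph $G$ with adjacency matrix $A$ and degree matrix $\Delta$, let $L=\Delta-A$ and $Q=\Delta+A$. For $M\in\{A,L,Q\}$, pair state transfer relative to $M$ at time $\tau$ means that there are vertices $a\ne b$ and $c\neq d$ with $\mathbf{e}_c-\mathbf{e}_d\ne\pm(\mathbf{e}_a-\mathbf{e}_b)$ and some $\gamma\in\mathbb{C}$ such that $\exp(i\tau M)(\mathbf{e}_a-\mathbf{e}_b)=\gamma(\mathbf{e}_c-\mathbf{e}_d)$, where $\mathbf{e}_a$ is the characteristic vector of vertex $a$. "Between the same pair states" means that the same $\mathbf{e}_a-\mathbf{e}_b$ and $\mathbf{e}_c-\mathbf{e}_d$ work for $M=A$, $M=L$ and $M=Q$. *)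

theory Defs
  imports
    Complex_Main
    "Jordan_Normal_Form.Matrix"
    "Graph_Theory.Graph_Theory"
begin

text \<open>
  Finite simple graphs are the symmetric, loop-free digraphs without parallel arcs of the locale
  \<^term>\<open>pair_graph\<close>. Matrices and vectors are indexed by \<open>0, \<dots>, n - 1\<close>, so the matrices below are
  meant for graphs whose vertex set is \<open>{..<n}\<close>; every finite graph is isomorphic to such a graph.
\<close>

definition valency :: "'a pair_pre_digraph \<Rightarrow> 'a \<Rightarrow> nat" where
  "valency G v = out_degree (with_proj G) v"

definition max_valency :: "'a pair_pre_digraph \<Rightarrow> nat" where
  "max_valency G = Max (valency G ` pverts G)"

definition regular_graph :: "'a pair_pre_digraph \<Rightarrow> bool" where
  "regular_graph G \<longleftrightarrow> (\<exists>r. \<forall>v\<in>pverts G. valency G v = r)"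

definition adjacency_matrix :: "nat pair_pre_digraph \<Rightarrow> complex mat" where
  "adjacency_matrix G =
    mat (card (pverts G)) (card (pverts G)) (\<lambda>(u, v). if (u, v) \<in> parcs G then 1 else 0)"

definition degree_matrix :: "nat pair_pre_digraph \<Rightarrow> complex mat" where
  "degree_matrix G =
    mat (card (pverts G)) (card (pverts G)) (\<lambda>(u, v). if u = v then of_nat (valency G u) else 0)"

definition laplacian_matrix :: "nat pair_pre_digraph \<Rightarrow> complex mat" where
  "laplacian_matrix G = degree_matrix G - adjacency_matrix G"

definition signless_laplacian_matrix :: "nat pair_pre_digraph \<Rightarrow> complex mat" where
  "signless_laplacian_matrix G = degree_matrix G + adjacency_matrix G"

text \<open>
  The exponential series, taken entrywise; for a square matrix each of these series of complex
  numbers converges absolutely.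
\<close>

definition mat_exp :: "complex mat \<Rightarrow> complex mat" where
  "mat_exp M = mat (dim_row M) (dim_row M) (\<lambda>(u, v). \<Sum>j. (M ^\<^sub>m j) $$ (u, v) / fact j)"

definition pair_state :: "nat \<Rightarrow> nat \<Rightarrow> nat \<Rightarrow> complex vec" where
  "pair_state n a b = unit_vec n a - unit_vec n b"

definition pair_state_transfer ::
    "complex mat \<Rightarrow> real \<Rightarrow> nat \<Rightarrow> nat \<Rightarrow> nat \<Rightarrow> nat \<Rightarrow> bool" where
  "pair_state_transfer M \<tau> a b c d \<longleftrightarrow>
    (let n = dim_row M in
      {a, b, c, d} \<subseteq> {..<n} \<and> a \<noteq> b \<and> c \<noteq> d \<and>
      pair_state n c d \<noteq> pair_state n a b \<and> pair_state n c d \<noteq> - pair_state n a b \<and>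
      (\<exists>\<gamma>. mat_exp ((\<i> * of_real \<tau>) \<cdot>\<^sub>m M) *\<^sub>v pair_state n a b = \<gamma> \<cdot>\<^sub>v pair_state n c d))"

end

theory Submission
  imports Defs "Jordan_Normal_Form.Jordan_Normal_Form"
begin

text \<open>
  Two triangles \<open>0, 2, 4\<close> and \<open>1, 3, 4\<close> share the vertex \<open>4\<close>. Whatever else is attached to \<open>4\<close>,
  the adjacency matrix exchanges \<open>e\<^sub>0 - e\<^sub>1\<close> and \<open>e\<^sub>2 - e\<^sub>3\<close>, because the contributions at \<open>4\<close> cancel,
  and the degree matrix acts on both as multiplication by \<open>2\<close>. So the sum and the difference of these
  two pair states are eigenvectors of \<open>A\<close>, \<open>L\<close> and \<open>Q\<close> whose eigenvalues differ by \<open>2\<close>, and at time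
  \<open>\<pi>/2\<close> their phases are opposite. Attaching \<open>k - 5\<close> leaves and a path to \<open>4\<close> gives maximum
  valency \<open>k\<close> and arbitrarily many vertices.
\<close>

section \<open>Exponentials on eigenvectors\<close>

text \<open>An entry of a product is a sum of \<open>n\<close> products, so each further factor
  \<open>M\<close> multiplies the entry bound by at most \<open>B * real n\<close>. The geometric
  form suits comparison with an exponential series.\<close>

lemma norm_bound_pow_mat:
  fixes M :: "complex mat"
  assumes M: "M \<in> carrier_mat n n" and B: "norm_bound M B" "B \<ge> 0"
  shows "norm_bound (M ^\<^sub>m j) ((1 + B * real n) ^ j)"
proof (induction j)
  case 0
  then show ?case using M by (auto simp: norm_bound_def)
next
  case (Suc j)
  have "norm_bound (M ^\<^sub>m j * M) ((1 + B * real n) ^ j * B * real n)"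
    using M Suc B norm_bound_mult[of "M ^\<^sub>m j" n n M n] by auto
  moreover have "(1 + B * real n) ^ j * B * real n \<le> (1 + B * real n) ^ Suc j"
    using B by (simp add: algebra_simps)
  ultimately show ?case
    unfolding norm_bound_def pow_mat.simps by (meson order_trans)
qed

lemma summable_mat_exp_entry:
  fixes M :: "complex mat"
  assumes M: "M \<in> carrier_mat n n" and "u < n" "v < n"
  shows "summable (\<lambda>j. (M ^\<^sub>m j) $$ (u, v) / fact j)"
proof -
  \<comment> \<open>Including \<open>0\<close> gives \<open>B \<ge> 0\<close> directly and keeps the
    set under the maximum nonempty.\<close>
  define B where "B = Max (insert 0 (norm ` elements_mat M))"
  have fin: "finite (insert 0 (norm ` elements_mat M))"
    unfolding elements_mat_def by auto
  have B: "B \<ge> 0" "norm_bound M B"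
    using fin by (auto simp: B_def intro!: norm_bound_bridge)
  let ?C = "1 + B * real n"
  have "norm ((M ^\<^sub>m j) $$ (u, v) / fact j) \<le> inverse (fact j) * ?C ^ j" for j
    using norm_bound_pow_mat[OF M B(2,1), of j] assms
    by (simp add: norm_bound_def norm_divide divide_simps)
  then show ?thesis
    by (intro summable_comparison_test[OF _ summable_exp[of ?C]]) auto
qed

lemma pow_mat_eigenvector:
  fixes M :: "'a::field mat"
  assumes M: "M \<in> carrier_mat n n" and x: "x \<in> carrier_vec n" and eig: "M *\<^sub>v x = l \<cdot>\<^sub>v x"
  shows "(M ^\<^sub>m j) *\<^sub>v x = l ^ j \<cdot>\<^sub>v x"
proof (induction j)
  case 0
  then show ?case using M x by auto
next
  case (Suc j)
  have "(M ^\<^sub>m Suc j) *\<^sub>v x = (M ^\<^sub>m j) *\<^sub>v (l \<cdot>\<^sub>v x)"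
    using M x eig by (simp add: assoc_mult_mat_vec[OF pow_carrier_mat[OF M] M])
  also have "\<dots> = l \<cdot>\<^sub>v (l ^ j \<cdot>\<^sub>v x)"
    using Suc x by (simp add: mult_mat_vec[OF pow_carrier_mat[OF M]])
  finally show ?case
    by (simp add: smult_smult_assoc)
qed

text \<open>On an eigenvector each power acts as a scalar power, so the matrix series collapses to
  the scalar exponential series. As \<open>mat_exp\<close> is an entrywise series, the finite sum of
  the matrix-vector product must be exchanged with it, which entrywise summability permits.\<close>

lemma mat_exp_eigenvector:
  assumes M: "M \<in> carrier_mat n n" and x: "x \<in> carrier_vec n" and eig: "M *\<^sub>v x = l \<cdot>\<^sub>v x"
  shows "mat_exp M *\<^sub>v x = exp l \<cdot>\<^sub>v x"
proof (rule eq_vecI)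
  show "dim_vec (mat_exp M *\<^sub>v x) = dim_vec (exp l \<cdot>\<^sub>v x)"
    using M x by (simp add: mat_exp_def)
  fix i assume "i < dim_vec (exp l \<cdot>\<^sub>v x)"
  then have i: "i < n" using x by simp
  have "(mat_exp M *\<^sub>v x) $ i = (\<Sum>u<n. (\<Sum>j. (M ^\<^sub>m j) $$ (i, u) / fact j) * x $ u)"
    using M x i by (simp add: mat_exp_def scalar_prod_def atLeast0LessThan)
  also have "\<dots> = (\<Sum>u<n. \<Sum>j. (M ^\<^sub>m j) $$ (i, u) / fact j * x $ u)"
    using summable_mat_exp_entry[OF M i] by (intro sum.cong refl suminf_mult2) auto
  also have "\<dots> = (\<Sum>j. \<Sum>u<n. (M ^\<^sub>m j) $$ (i, u) / fact j * x $ u)"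
    using summable_mat_exp_entry[OF M i]
    by (intro suminf_sum[symmetric] summable_mult2) auto
  also have "\<dots> = (\<Sum>j. ((M ^\<^sub>m j) *\<^sub>v x) $ i / fact j)"
    using M x i by (simp add: scalar_prod_def atLeast0LessThan sum_divide_distrib)
  also have "\<dots> = (\<Sum>j. l ^ j / fact j * x $ i)"
    using x i by (simp add: pow_mat_eigenvector[OF assms])
  also have "\<dots> = exp l * x $ i"
    using sums_mult2[OF exp_converges[of l], of "x $ i"]
    by (simp add: scaleR_conv_of_real field_simps sums_iff)
  finally show "(mat_exp M *\<^sub>v x) $ i = (exp l \<cdot>\<^sub>v x) $ i"
    using x i by simp
qed

section \<open>Exchanging two vectors by the exponential\<close>

lemma mat_exp_carrier: "M \<in> carrier_mat n n \<Longrightarrow> mat_exp M \<in> carrier_mat n n"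
  by (simp add: mat_exp_def)

lemma pair_state_carrier: "pair_state n a b \<in> carrier_vec n"
  by (simp add: pair_state_def)

lemma index_pair_state:
  "\<lbrakk>i < n; a < n; b < n\<rbrakk> \<Longrightarrow>
    pair_state n a b $ i = (if i = a then 1 else 0) - (if i = b then 1 else 0)"
  by (simp add: pair_state_def)

lemma dim_pair_state: "dim_vec (pair_state n a b) = n"
  by (simp add: pair_state_def)

text \<open>The vectors \<open>x + y\<close> and \<open>x - y\<close> are eigenvectors for
  \<open>l + s\<close> and \<open>l - s\<close>. With opposite exponentials,
  \<open>mat_exp M\<close> acts on their span as \<open>exp (l + s)\<close> times the exchange of
  \<open>x\<close> and \<open>y\<close>.\<close>

lemma mat_exp_swap:
  assumes M: "M \<in> carrier_mat n n" and x: "x \<in> carrier_vec n" and y: "y \<in> carrier_vec n"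
    and Mx: "M *\<^sub>v x = l \<cdot>\<^sub>v x + s \<cdot>\<^sub>v y" and My: "M *\<^sub>v y = l \<cdot>\<^sub>v y + s \<cdot>\<^sub>v x"
    and opposite: "exp (l - s) = - exp (l + s)"
  shows "mat_exp M *\<^sub>v x = exp (l + s) \<cdot>\<^sub>v y"
proof -
  have plus: "mat_exp M *\<^sub>v (x + y) = exp (l + s) \<cdot>\<^sub>v (x + y)"
    using M x y Mx My
    by (intro mat_exp_eigenvector[OF M])
      (auto simp: mult_add_distrib_mat_vec[OF M x y] algebra_simps)
  have minus: "mat_exp M *\<^sub>v (x - y) = exp (l - s) \<cdot>\<^sub>v (x - y)"
    using M x y Mx My
    by (intro mat_exp_eigenvector[OF M])
      (auto simp: mult_minus_distrib_mat_vec[OF M x y] algebra_simps)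
  note E = mat_exp_carrier[OF M]
  have "(1/2) \<cdot>\<^sub>v ((x + y) + (x - y)) = x"
    using x y by auto
  then have "mat_exp M *\<^sub>v x = mat_exp M *\<^sub>v ((1/2) \<cdot>\<^sub>v ((x + y) + (x - y)))"
    by simp
  also have "\<dots> = (1/2) \<cdot>\<^sub>v (mat_exp M *\<^sub>v (x + y) + mat_exp M *\<^sub>v (x - y))"
    using x y
    by (simp only: mult_mat_vec[OF E] mult_add_distrib_mat_vec[OF E] add_carrier_vec minus_carrier_vec)
  also have "\<dots> = exp (l + s) \<cdot>\<^sub>v y"
    unfolding plus minus opposite using x y by (auto simp: algebra_simps)
  finally show ?thesis .
qed

text \<open>The eigenvalues \<open>l + s\<close> and \<open>l - s\<close> differ by 2 in absolute
  value, so time \<pi>/2 separates their phases by \<pi>, while \<open>l\<close> only contributes a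
  common factor.\<close>

lemma pair_state_transfer_swap:
  assumes M: "M \<in> carrier_mat n n"
    and distinct: "distinct [a, b, c, d]" and less: "{a, b, c, d} \<subseteq> {..<n}"
    and Mab: "M *\<^sub>v pair_state n a b = l \<cdot>\<^sub>v pair_state n a b + s \<cdot>\<^sub>v pair_state n c d"
    and Mcd: "M *\<^sub>v pair_state n c d = l \<cdot>\<^sub>v pair_state n c d + s \<cdot>\<^sub>v pair_state n a b"
    and s: "s = 1 \<or> s = - 1"
  shows "pair_state_transfer M (pi / 2) a b c d"
proof -
  define z :: complex where "z = \<i> * of_real (pi / 2)"
  have exp_z: "exp z = \<i>" "exp (- z) = - \<i>"
    using cis_conv_exp[of "pi / 2"] by (simp_all add: z_def exp_minus)
  have smult: "(z \<cdot>\<^sub>m M) *\<^sub>v x = z \<cdot>\<^sub>v (M *\<^sub>v x)" if "x \<in> carrier_vec n" for x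
    using M that by (auto simp: scalar_prod_def sum_distrib_left mult.assoc)
  have "mat_exp (z \<cdot>\<^sub>m M) *\<^sub>v pair_state n a b = exp (z * l + z * s) \<cdot>\<^sub>v pair_state n c d"
  proof (rule mat_exp_swap)
    show "(z \<cdot>\<^sub>m M) *\<^sub>v pair_state n a b =
        (z * l) \<cdot>\<^sub>v pair_state n a b + (z * s) \<cdot>\<^sub>v pair_state n c d"
      unfolding smult[OF pair_state_carrier] Mab
      by (intro eq_vecI) (auto simp: dim_pair_state algebra_simps)
    show "(z \<cdot>\<^sub>m M) *\<^sub>v pair_state n c d =
        (z * l) \<cdot>\<^sub>v pair_state n c d + (z * s) \<cdot>\<^sub>v pair_state n a b"
      unfolding smult[OF pair_state_carrier] Mcd
      by (intro eq_vecI) (auto simp: dim_pair_state algebra_simps)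
    show "exp (z * l - z * s) = - exp (z * l + z * s)"
      using s exp_z by (auto simp: exp_add exp_diff exp_minus)
  qed (use M pair_state_carrier in auto)
  \<comment> \<open>Coordinate \<open>a\<close> is 0 in the target state and 1 or -1 in the source
    state and its negative.\<close>
  moreover have "pair_state n c d $ a \<noteq> pair_state n a b $ a"
    "pair_state n c d $ a \<noteq> (- pair_state n a b) $ a"
    using distinct less by (auto simp: pair_state_def)
  ultimately show ?thesis
    using M distinct less unfolding pair_state_transfer_def Let_def z_def by auto
qed

lemma index_mult_pair_state:
  assumes "A \<in> carrier_mat n n" "i < n" "a < n" "b < n"
  shows "(A *\<^sub>v pair_state n a b) $ i = A $$ (i, a) - A $$ (i, b)"
  using assms
  by (simp add: pair_state_def scalar_prod_minus_distrib[OF row_carrier_vec])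

section \<open>Butterflies with a broom\<close>

text \<open>Each edge is listed once, smaller endpoint first. The vertices from 5 to
  \<open>k - 1\<close> are the leaves at the hub 4; vertex \<open>k\<close> is also joined to the
  hub and starts the path, which has no end until the vertex set cuts it off.\<close>

definition broom_edge :: "nat \<Rightarrow> nat \<Rightarrow> nat \<Rightarrow> bool" where
  "broom_edge k u v \<longleftrightarrow>
    u = 0 \<and> v = 2 \<or> u = 1 \<and> v = 3 \<or> u < 4 \<and> v = 4 \<or>
    u = 4 \<and> 5 \<le> v \<and> v \<le> k \<or> k \<le> u \<and> v = Suc u"

text \<open>The path runs from \<open>k\<close> to \<open>k + m\<close>. Vertex \<open>k\<close> is
  present even for \<open>m = 0\<close>, so the hub keeps all its neighbours for every
  \<open>m\<close>.\<close>

definition butterfly_broom :: "nat \<Rightarrow> nat \<Rightarrow> nat pair_pre_digraph" where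
  "butterfly_broom k m =
    \<lparr>pverts = {..<Suc (k + m)},
     parcs = {(u, v). u < Suc (k + m) \<and> v < Suc (k + m) \<and> (broom_edge k u v \<or> broom_edge k v u)}\<rparr>"

lemma butterfly_broom_simps [simp]:
  "pverts (butterfly_broom k m) = {..<Suc (k + m)}"
  "(u, v) \<in> parcs (butterfly_broom k m) \<longleftrightarrow>
    u < Suc (k + m) \<and> v < Suc (k + m) \<and> (broom_edge k u v \<or> broom_edge k v u)"
  by (simp_all add: butterfly_broom_def)

lemma pair_graph_butterfly_broom:
  assumes "k \<ge> 5"
  shows "pair_graph (butterfly_broom k m)"
proof
  have "parcs (butterfly_broom k m) \<subseteq> {..<Suc (k + m)} \<times> {..<Suc (k + m)}"
    by auto
  then show "finite (parcs (butterfly_broom k m))"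
    by (rule finite_subset) auto
  show "symmetric (with_proj (butterfly_broom k m))"
    by (auto simp: symmetric_def intro!: symI)
  show "fst e \<noteq> snd e" if "e \<in> parcs (butterfly_broom k m)" for e
    using that assms by (cases e) (auto simp: broom_edge_def)
qed (auto simp: butterfly_broom_def)

text \<open>Every vertex reaches the hub: up to label \<open>k\<close> in at most one step, beyond
  it by descending along the path. Symmetry of the arcs then joins any two vertices through the
  hub.\<close>

lemma connected_butterfly_broom:
  assumes k: "k \<ge> 5"
  shows "Digraph_Component.connected (with_proj (butterfly_broom k m))"
proof -
  let ?G = "butterfly_broom k m"
  interpret pair_graph ?G by (rule pair_graph_butterfly_broom[OF k])
  have to_hub: "v \<rightarrow>\<^sup>*\<^bsub>with_proj ?G\<^esub> 4" if "v < Suc (k + m)" for v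
    using that
  proof (induction v rule: less_induct)
    case (less v)
    consider "v = 4" | "v \<noteq> 4" "v \<le> k" | "v > k" by linarith
    then show ?case
    proof cases
      case 1
      then show ?thesis using k by (auto intro: reachable_refl)
    next
      case 2
      then have "(v, 4) \<in> parcs ?G"
        using k by (auto simp: broom_edge_def)
      then show ?thesis by (intro reachable_adjI) auto
    next
      case 3
      then have "(v, v - 1) \<in> parcs ?G"
        using k less.prems by (auto simp: broom_edge_def)
      moreover have "(v - 1) \<rightarrow>\<^sup>*\<^bsub>with_proj ?G\<^esub> 4"
        using 3 less by (intro less.IH) auto
      ultimately show ?thesis
        by (intro adj_reachable_trans[of v "v - 1" 4]) auto
    qed
  qed
  have "strongly_connected (with_proj ?G)"
  proof (rule strongly_connectedI)
    fix u v assume "u \<in> verts (with_proj ?G)" "v \<in> verts (with_proj ?G)"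
    then show "u \<rightarrow>\<^sup>*\<^bsub>with_proj ?G\<^esub> v"
      using to_hub[of u] to_hub[of v] by (auto intro: reachable_trans symmetric_reachable')
  qed auto
  \<comment> \<open>Connectedness means strong connectedness of the symmetric closure; since the
    arcs are already symmetric, reachability is the same there.\<close>
  then show ?thesis
    by (simp add: connected_def strongly_connected_def reachable_mk_symmetric_eq[OF pair_sym_arcs])
qed

section \<open>Valencies\<close>

lemma valency_eq_card: "valency G v = card {w. (v, w) \<in> parcs G}"
proof -
  have "{e \<in> parcs G. fst e = v} = Pair v ` {w. (v, w) \<in> parcs G}"
    by auto
  then show ?thesis
    by (simp add: valency_def out_degree_def out_arcs_def card_image inj_on_def)
qed

lemma valency_butterfly_broom_wing:
  assumes "k \<ge> 5" "v < 4"
  shows "valency (butterfly_broom k m) v = 2"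
proof -
  \<comment> \<open>The first element is the other outer vertex of the same triangle; the triangles
    pair 0 with 2 and 1 with 3.\<close>
  have "{w. (v, w) \<in> parcs (butterfly_broom k m)} = {if v < 2 then v + 2 else v - 2, 4}"
    using assms by (auto simp: broom_edge_def)
  then show ?thesis using assms by (simp add: valency_eq_card)
qed

lemma valency_butterfly_broom_hub:
  assumes "k \<ge> 5"
  shows "valency (butterfly_broom k m) 4 = k"
proof -
  have "{w. (4, w) \<in> parcs (butterfly_broom k m)} = {..k} - {4}"
    using assms by (auto simp: broom_edge_def)
  then show ?thesis using assms by (simp add: valency_eq_card)
qed

text \<open>The only candidates for neighbours are one vertex towards the hub and the successor on
  the path. Leaves and the end of the path have valency 1 and inner path vertices valency 2, so a
  common bound is what the maximum calls for.\<close>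

lemma valency_butterfly_broom_tail:
  assumes "k \<ge> 5" "v > 4"
  shows "valency (butterfly_broom k m) v \<le> 2"
proof -
  have "{w. (v, w) \<in> parcs (butterfly_broom k m)} \<subseteq> {if v \<le> k then 4 else v - 1, Suc v}"
    using assms by (auto simp: broom_edge_def)
  then have "valency (butterfly_broom k m) v \<le> card {if v \<le> k then 4 else v - 1, Suc v}"
    unfolding valency_eq_card by (intro card_mono) auto
  also have "\<dots> \<le> 2"
    by (rule order_trans[OF card_insert_le_m1]) auto
  finally show ?thesis .
qed

lemma max_valency_butterfly_broom:
  assumes "k \<ge> 5"
  shows "max_valency (butterfly_broom k m) = k"
  unfolding max_valency_def
proof (rule Max_eqI)
  show "finite (valency (butterfly_broom k m) ` pverts (butterfly_broom k m))"
    by simp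
  show "k \<in> valency (butterfly_broom k m) ` pverts (butterfly_broom k m)"
    using assms valency_butterfly_broom_hub[OF assms, of m] by (intro image_eqI[of _ _ 4]) auto
  fix y assume "y \<in> valency (butterfly_broom k m) ` pverts (butterfly_broom k m)"
  then obtain v where y: "y = valency (butterfly_broom k m) v" by auto
  consider "v < 4" | "v = 4" | "v > 4" by linarith
  then show "y \<le> k"
    using assms valency_butterfly_broom_wing[OF assms, of v m]
      valency_butterfly_broom_hub[OF assms, of m] valency_butterfly_broom_tail[OF assms, of v m]
    unfolding y by cases auto
qed

lemma not_regular_butterfly_broom:
  assumes "k \<ge> 5"
  shows "\<not> regular_graph (butterfly_broom k m)"
proof -
  have "valency (butterfly_broom k m) 0 \<noteq> valency (butterfly_broom k m) 4"
    using assms by (simp add: valency_butterfly_broom_wing valency_butterfly_broom_hub)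
  moreover have "0 \<in> pverts (butterfly_broom k m)" "4 \<in> pverts (butterfly_broom k m)"
    using assms by auto
  ultimately show ?thesis
    unfolding regular_graph_def by metis
qed

section \<open>State transfer and the infinite family\<close>

lemma pair_state_transfer_butterfly_broom:
  assumes k: "k \<ge> 5"
    and M: "M \<in> {adjacency_matrix (butterfly_broom k m), laplacian_matrix (butterfly_broom k m),
      signless_laplacian_matrix (butterfly_broom k m)}"
  shows "pair_state_transfer M (pi / 2) 0 1 2 3"
proof -
  define n where "n = Suc (k + m)"
  define A where "A = adjacency_matrix (butterfly_broom k m)"
  define D where "D = degree_matrix (butterfly_broom k m)"
  let ?p = "pair_state n 0 1" and ?q = "pair_state n 2 3"
  have n: "n > 4" using k by (simp add: n_def)
  have carrier: "A \<in> carrier_mat n n" "D \<in> carrier_mat n n"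
    by (simp_all add: A_def D_def adjacency_matrix_def degree_matrix_def n_def)
  have A_index: "A $$ (i, j) = (if broom_edge k i j \<or> broom_edge k j i then 1 else 0)"
    if "i < n" "j < n" for i j
    using that by (simp add: A_def adjacency_matrix_def n_def)
  \<comment> \<open>Both states are supported on the columns below 4, so only the wing valencies,
    all equal to 2, enter.\<close>
  have D_index: "D $$ (i, j) = (if i = j then 2 else 0)" if "i < n" "j < 4" for i j
    using that n valency_butterfly_broom_wing[OF k, of j m]
    by (auto simp: D_def degree_matrix_def n_def)
  \<comment> \<open>Rows below 4 see the edges 0-2 and 1-3, row 4 gives 1 - 1 = 0, and later rows
    vanish on these columns. Removing \<open>index_mult_mat_vec\<close> keeps the product intact for
    \<open>index_mult_pair_state\<close>.\<close>
  have A: "A *\<^sub>v ?p = ?q" "A *\<^sub>v ?q = ?p"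
    using carrier n k
    by (auto intro!: eq_vecI simp: index_mult_pair_state A_index index_pair_state
        dim_pair_state broom_edge_def
        simp del: index_mult_mat_vec)
  have D: "D *\<^sub>v ?p = 2 \<cdot>\<^sub>v ?p" "D *\<^sub>v ?q = 2 \<cdot>\<^sub>v ?q"
    using carrier n
    by (auto intro!: eq_vecI simp: index_mult_pair_state D_index index_pair_state
        dim_pair_state
        simp del: index_mult_mat_vec)
  note transfer = pair_state_transfer_swap[where n = n]
  \<comment> \<open>Here \<open>l\<close> is the contribution of \<open>D\<close> and
    \<open>s\<close> the sign of \<open>A\<close>: 0 and 1 for \<open>A\<close>, 2 and -1 for
    \<open>D - A\<close>, 2 and 1 for \<open>D + A\<close>.\<close>
  have "pair_state_transfer A (pi / 2) 0 1 2 3"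
    by (rule transfer[where l = 0 and s = 1]) (use carrier n A in \<open>auto simp: pair_state_def\<close>)
  moreover have "pair_state_transfer (D - A) (pi / 2) 0 1 2 3"
    by (rule transfer[where l = 2 and s = "- 1"])
      (use carrier n A D pair_state_carrier in
        \<open>auto simp: minus_mult_distrib_mat_vec[where nr = n and nc = n] pair_state_def\<close>)
  moreover have "pair_state_transfer (D + A) (pi / 2) 0 1 2 3"
    by (rule transfer[where l = 2 and s = 1])
      (use carrier n A D pair_state_carrier in
        \<open>auto simp: add_mult_distrib_mat_vec[where nr = n and nc = n] pair_state_def\<close>)
  ultimately show ?thesis
    using M by (auto simp: laplacian_matrix_def signless_laplacian_matrix_def A_def D_def)
qed

text \<open>An isomorphism is injective on vertices and maps them onto those of the target. The
  order thus serves as the invariant that tells the members of the family apart.\<close>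

lemma digraph_iso_card_verts:
  assumes "digraph_iso G H"
  shows "card (verts H) = card (verts G)"
  using assms unfolding digraph_iso_def pre_digraph.digraph_isomorphism_def
  by (auto simp: card_image)

theorem theorem13:
  fixes k :: nat
  assumes "k \<ge> 5"
  shows "\<exists>\<G> :: nat pair_pre_digraph set.
    infinite \<G> \<and>
    pairwise (\<lambda>G H. \<not> digraph_iso (with_proj G) (with_proj H)) \<G> \<and>
    (\<forall>G\<in>\<G>. pair_graph G \<and> (\<exists>n. pverts G = {..<n}) \<and>
       Digraph_Component.connected (with_proj G) \<and>
       \<not> regular_graph G \<and> max_valency G = k \<and>
       (\<exists>a b c d. \<forall>M\<in>{adjacency_matrix G, laplacian_matrix G, signless_laplacian_matrix G}.
          pair_state_transfer M (pi / 2) a b c d))"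
proof (intro exI[of _ "range (butterfly_broom k)"] conjI ballI)
  have card: "card (verts (with_proj (butterfly_broom k m))) = Suc (k + m)" for m
    by simp
  \<comment> \<open>The order \<open>Suc (k + m)\<close> determines \<open>m\<close>; this gives
    infinitely many graphs and, below, pairwise non-isomorphism.\<close>
  have "inj (butterfly_broom k)"
    by (metis add_left_cancel card injI nat.inject)
  then show "infinite (range (butterfly_broom k))"
    by (rule range_inj_infinite)
  show "pairwise (\<lambda>G H. \<not> digraph_iso (with_proj G) (with_proj H)) (range (butterfly_broom k))"
    by (auto simp: pairwise_def dest!: digraph_iso_card_verts)
next
  fix G assume "G \<in> range (butterfly_broom k)"
  then obtain m where G: "G = butterfly_broom k m" by auto
  show "pair_graph G"
    unfolding G by (rule pair_graph_butterfly_broom[OF assms])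
  show "\<exists>n. pverts G = {..<n}"
    unfolding G by auto
  show "Digraph_Component.connected (with_proj G)"
    unfolding G by (rule connected_butterfly_broom[OF assms])
  show "\<not> regular_graph G"
    unfolding G by (rule not_regular_butterfly_broom[OF assms])
  show "max_valency G = k"
    unfolding G by (rule max_valency_butterfly_broom[OF assms])
  \<comment> \<open>The witnesses 0, 1, 2, 3 serve all three matrices at once, as transfer between
    the same pair states demands.\<close>
  show "\<exists>a b c d. \<forall>M\<in>{adjacency_matrix G, laplacian_matrix G, signless_laplacian_matrix G}.
      pair_state_transfer M (pi / 2) a b c d"
    unfolding G using pair_state_transfer_butterfly_broom[OF assms] by blast
qed

end
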